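(* Let $\mathbb{K}$ be an algebraically closed field of characteristic zero. Let $A$ be a subalgebra of $\mathbb{K}[x]$ of codimension three whose spectrum consists of five elements. Then its elements can be named $\alpha,\beta,\gamma,\delta,\lambda$ such that, with $$p_i(x)=(x-\alpha)(x-\beta)(x-\gamma)(x-\delta)(x-\lambda)^i,\quad g(x)=\left(x-\tfrac{\alpha+\beta}{2}\right)^2,\quad \Delta=\gamma+\delta-\alpha-\beta,$$ and, if $\Delta\neq0$, $$q(x)=(x-\alpha)(x-\beta)(x-\tau),\quad \tau=\frac{\gamma^2+\gamma\delta+\delta^2+\alpha\beta-(\alpha+\beta)(\gamma+\delta)}{\Delta},$$ $A$ is one of the following. (I) $A=\{f\mid f(\alpha)=f(\beta)=f(\lambda),\ f(\gamma)=f(\delta)\}$. In this case let $L(f)=f(\alpha)-f(\lambda)$. The possible types are: - $T(A)=(4,5,6,7)$. This occurs when $\Delta=0$, or when $\Delta\neq0$ and $L(q)\neq0$. A SAGBI basis in the first case is $L(p_0)g-L(g)p_0,\ p_1,\ p_2,\ p_3$, and in the second case $L(q)p_0-L(p_0)q,\ p_1,\ p_2,\ p_3$. - $T(A)=(3,5,7)$. This occurs when $\Delta\neq0$, $L(q)=0$ and $L(p_0)\neq0$. A SAGBI basis is $q,\ p_1,\ p_3$. - $T(A)=(3,4)$. This occurs when $\Delta\neq0$ and $L(q)=L(p_0)=0$. A SAGBI basis is $q,\ p_0$. (II) $A=\{f\mid f(\alpha)=f(\beta),\ f(\gamma)=f(\delta),\ f'(\lambda)=0\}$. In this case let $D(f)=f'(\lambda)$.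 The possible types are: - $T(A)=(2,7)$. This occurs when $\Delta=0$ and $\lambda=\frac{\alpha+\beta}{2}$. A SAGBI basis is $g,\ p_3$. - $T(A)=(4,5,6,7)$. This occurs when $\Delta=0$ and $\lambda\neq\frac{\alpha+\beta}{2}$, or when $\Delta\neq0$ and $D(q)\neq0$. A SAGBI basis in the first case is $D(p_0)g-D(g)p_0,\ D(p_1)g-D(g)p_1,\ p_2,\ p_3$, and in the second case $D(p_0)q-D(q)p_0,\ D(p_1)q-D(q)p_1,\ p_2,\ p_3$. - $T(A)=(3,5,7)$. This occurs when $\Delta\neq0$, $D(q)=0$ and $D(p_0)\neq0$. A SAGBI basis is $q,\ D(p_0)p_1-D(p_1)p_0,\ p_3$. - $T(A)=(3,4)$. This occurs when $\Delta\neq0$ and $D(q)=D(p_0)=0$. A SAGBI basis is $q,\ p_0$.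
   Context: Subalgebras of $\mathbb{K}[x]$ contain all constants; codimension of $A$ is $\dim_{\mathbb{K}}\mathbb{K}[x]/A$; sets $\{f\mid\dots\}$ range over $f\in\mathbb{K}[x]$. The spectrum $Sp(A)$ of a subalgebra $A$ of finite codimension is the set of $\alpha\in\mathbb{K}$ such that either $f'(\alpha)=0$ for all $f\in A$, or there exists $\beta\neq\alpha$ in $\mathbb{K}$ with $f(\alpha)=f(\beta)$ for all $f\in A$. A SAGBI basis of $A$ is a finite set $G$ of non-constant polynomials in $A$ whose degrees generate the semigroup $S=\{\deg f\mid f\in A\text{ non-constant}\}$. The type $T(A)$ is the ordered list of minimal generators of $S$. The items listing when a type occurs are to be read as: under the stated condition, $A$ has that type and the stated SAGBI basis. *)

theory Defs
  imports "HOL-Computational_Algebra.Polynomial"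
begin

(* Closure under scalar multiplication follows, since A contains the constants. *)
definition poly_subalgebra :: "'a::field poly set \<Rightarrow> bool" where
  "poly_subalgebra A \<longleftrightarrow>
     (\<forall>c. [:c:] \<in> A) \<and> (\<forall>f\<in>A. \<forall>g\<in>A. f + g \<in> A) \<and> (\<forall>f\<in>A. \<forall>g\<in>A. f * g \<in> A)"

(* dim K[x]/A = n: the cosets b + A, for b in some set B of n polynomials, span the quotient
   space (first clause on B) and are linearly independent in it (second clause). *)
definition has_codimension :: "'a::field poly set \<Rightarrow> nat \<Rightarrow> bool" where
  "has_codimension A n \<longleftrightarrow>
     (\<exists>B. finite B \<and> card B = n \<and>
        (\<forall>f. \<exists>c. f - (\<Sum>b\<in>B. smult (c b) b) \<in> A) \<and>
        (\<forall>c. (\<Sum>b\<in>B. smult (c b) b) \<in> A \<longrightarrow> (\<forall>b\<in>B. c b = 0)))"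

definition spectrum :: "'a::field poly set \<Rightarrow> 'a set" where
  "spectrum A =
     {\<alpha>. (\<forall>f\<in>A. poly (pderiv f) \<alpha> = 0) \<or> (\<exists>\<beta>. \<beta> \<noteq> \<alpha> \<and> (\<forall>f\<in>A. poly f \<alpha> = poly f \<beta>))}"

inductive_set semigroup_gen :: "nat set \<Rightarrow> nat set" for D :: "nat set" where
  base: "d \<in> D \<Longrightarrow> d \<in> semigroup_gen D"
| add: "\<lbrakk>m \<in> semigroup_gen D; n \<in> semigroup_gen D\<rbrakk> \<Longrightarrow> m + n \<in> semigroup_gen D"

definition degree_semigroup :: "'a::field poly set \<Rightarrow> nat set" where
  "degree_semigroup A = {degree f | f. f \<in> A \<and> degree f > 0}"

definition SAGBI_basis :: "'a::field poly set \<Rightarrow> 'a poly set \<Rightarrow> bool" where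
  "SAGBI_basis A G \<longleftrightarrow>
     finite G \<and> G \<subseteq> A \<and> (\<forall>g\<in>G. degree g > 0) \<and>
     semigroup_gen (degree ` G) = degree_semigroup A"

(* The elements of S that are not generated by the other elements of S. For an additive
   semigroup S of positive integers they form the unique minimal generating set of S. *)
definition minimal_generators :: "nat set \<Rightarrow> nat set" where
  "minimal_generators S = {s \<in> S. s \<notin> semigroup_gen (S - {s})}"

(* The set being listed is finite for every subalgebra A, as subsemigroups of the natural
   numbers are finitely generated. *)
definition subalgebra_type :: "'a::field poly set \<Rightarrow> nat list" where
  "subalgebra_type A = sorted_list_of_set (minimal_generators (degree_semigroup A))"

end

theory Submission
  imports Defs
begin

text \<open>
  Every spectral element imposes a linear condition on \<open>A\<close>: two values agree, or a derivative
  vanishes. Values and derivatives at distinct points are independent functionals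
  (\<open>hermite_interpolation\<close>), and no more than three independent functionals can vanish on a
  subspace of codimension three; if exactly three do, the subspace is their common kernel
  (\<open>point_conditions_codimension\<close>). Call two points glued if no element of \<open>A\<close> separates them.
  If the five spectral elements contain \<open>r\<close> glueing classes with at least two points, they yield
  \<open>5 - r\<close> independent conditions, so \<open>r \<ge> 2\<close>. This leaves two disjoint glued pairs and a fifth
  element that either joins one of the pairs or is a common critical point, and in both cases the
  three conditions so obtained determine \<open>A\<close>. This is where the two families come from.

  The types follow from counting. If \<open>n\<close> positive integers are missing from the degrees of a
  subalgebra, then the monomials with these exponents span the quotient space, so a subalgebra of
  codimension three misses at least three degrees. Hence as soon as elements of \<open>A\<close> are
  found whose degrees generate all but three positive integers, there are no further degrees and
  these elements form a SAGBI basis (\<open>SAGBI_basis_and_type_by_gaps\<close>). The four types correspond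
  to the sets of gaps \<open>{1, 2, 3}\<close>, \<open>{1, 2, 4}\<close>, \<open>{1, 2, 5}\<close> and \<open>{1, 3, 5}\<close>. The required elements
  are built from polynomials that satisfy the conditions for the two pairs, of degree 2 (if
  \<open>\<Delta> = 0\<close>) or 3 (if \<open>\<Delta> \<noteq> 0\<close>) and of all degrees from 4 on. The condition at the fifth element
  is a single linear equation, so a suitable linear combination of any two of them
  meets it; which degrees arise depends on which of them meet the condition already.
\<close>

section \<open>Linear algebra modulo a subalgebra\<close>

lemma subalgebra_smult:
  assumes "poly_subalgebra A" "f \<in> A"
  shows "smult c f \<in> A"
proof -
  have "[:c:] * f \<in> A" using assms unfolding poly_subalgebra_def by blast
  thus ?thesis by simp
qed

lemma subalgebra_const: "poly_subalgebra A \<Longrightarrow> [:c:] \<in> A"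
  unfolding poly_subalgebra_def by blast

lemma subalgebra_zero: "poly_subalgebra A \<Longrightarrow> 0 \<in> A"
  using subalgebra_const[of A 0] by simp

lemma subalgebra_add: "poly_subalgebra A \<Longrightarrow> f \<in> A \<Longrightarrow> g \<in> A \<Longrightarrow> f + g \<in> A"
  unfolding poly_subalgebra_def by blast

lemma subalgebra_sum: "poly_subalgebra A \<Longrightarrow> (\<And>i. i \<in> I \<Longrightarrow> f i \<in> A) \<Longrightarrow> sum f I \<in> A"
  by (induction I rule: infinite_finite_induct) (auto simp: subalgebra_zero subalgebra_add)

text \<open>
  The Steinitz exchange lemma in the quotient space by \<open>A\<close>, for indexed families. Replacing each
  \<open>e i\<close> by the congruent combination of the \<open>b j\<close> moves the question into the space of
  polynomials itself, where it is the usual bound for independent vectors in a finite span.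
\<close>

lemma independent_mod_card_le_spanning_mod:
  fixes A :: "'k::field poly set"
  assumes A: "poly_subalgebra A" and fin: "finite I" "finite J"
    and span: "\<And>f. \<exists>c. f - (\<Sum>j\<in>J. smult (c j) (b j)) \<in> A"
    and indep: "\<And>c i. (\<Sum>i\<in>I. smult (c i) (e i)) \<in> A \<Longrightarrow> i \<in> I \<Longrightarrow> c i = 0"
  shows "card I \<le> card J"
proof -
  interpret V: vector_space "smult :: 'k \<Rightarrow> 'k poly \<Rightarrow> 'k poly"
    by unfold_locales (auto simp: smult_add_left smult_add_right)
  have "\<forall>i. \<exists>c. e i - (\<Sum>j\<in>J. smult (c j) (b j)) \<in> A" using span ..
  from choice[OF this] obtain C
    where C: "\<forall>i. e i - (\<Sum>j\<in>J. smult (C i j) (b j)) \<in> A" ..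
  define w where "w i = (\<Sum>j\<in>J. smult (C i j) (b j))" for i
  have w_indep: "d i = 0" if "(\<Sum>i\<in>I. smult (d i) (w i)) = 0" "i \<in> I" for d i
  proof -
    have "(\<Sum>i\<in>I. smult (d i) (e i)) = (\<Sum>i\<in>I. smult (d i) (e i - w i))"
      using that(1) by (simp add: smult_diff_right sum_subtractf)
    also have "\<dots> \<in> A"
      using C by (intro subalgebra_sum[OF A] subalgebra_smult[OF A]) (simp add: w_def)
    finally show ?thesis using that(2) by (rule indep)
  qed
  \<comment> \<open>Two equal vectors would satisfy the relation with coefficients 1 and -1.\<close>
  have inj: "inj_on w I"
  proof (rule inj_onI, rule ccontr)
    fix i k assume ik: "i \<in> I" "k \<in> I" "w i = w k" "i \<noteq> k"
    define d :: "_ \<Rightarrow> 'k" where "d l = (if l = i then 1 else if l = k then -1 else 0)" for l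
    have "(\<Sum>l\<in>I. smult (d l) (w l)) = (\<Sum>l\<in>{i,k}. smult (d l) (w l))"
      using ik fin by (intro sum.mono_neutral_right) (auto simp: d_def)
    also have "\<dots> = 0" using ik by (simp add: d_def)
    finally have "d i = 0" using ik(1) by (rule w_indep)
    thus False by (simp add: d_def)
  qed
  have "V.independent (w ` I)"
  proof (rule V.independent_if_scalars_zero)
    fix u x assume u: "(\<Sum>x\<in>w ` I. smult (u x) x) = 0" and "x \<in> w ` I"
    then obtain i where i: "i \<in> I" "x = w i" by blast
    have "(\<Sum>i\<in>I. smult (u (w i)) (w i)) = 0"
      using u by (simp add: sum.reindex[OF inj])
    from w_indep[OF this i(1)] show "u x = 0" using i by simp
  qed (use fin in auto)
  moreover have "w ` I \<subseteq> V.span (b ` J)"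
    unfolding w_def by (intro image_subsetI V.span_sum V.span_scale V.span_base imageI)
  ultimately have "card (w ` I) \<le> card (b ` J)"
    using V.independent_span_bound fin by blast
  also have "\<dots> \<le> card J" using fin card_image_le by blast
  finally show ?thesis by (simp add: card_image[OF inj])
qed

lemma has_codimensionE:
  assumes "has_codimension A n"
  obtains B where "finite B" "card B = n" "\<forall>f. \<exists>c. f - (\<Sum>b\<in>B. smult (c b) b) \<in> A"
    "\<forall>c. (\<Sum>b\<in>B. smult (c b) b) \<in> A \<longrightarrow> (\<forall>b\<in>B. c b = 0)"
  using assms unfolding has_codimension_def
  by (elim exE conjE) (rule that; assumption)

lemma has_codimension_independent_le:
  fixes A :: "'k::field poly set"
  assumes A: "poly_subalgebra A" "has_codimension A n" and fin: "finite I"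
    and indep: "\<And>c i. (\<Sum>i\<in>I. smult (c i) (e i)) \<in> A \<Longrightarrow> i \<in> I \<Longrightarrow> c i = 0"
  shows "card I \<le> n"
proof -
  from A(2) obtain B where B: "finite B" "card B = n"
    "\<forall>f. \<exists>c. f - (\<Sum>b\<in>B. smult (c b) b) \<in> A" by (rule has_codimensionE)
  have "card I \<le> card B"
    by (rule independent_mod_card_le_spanning_mod[OF A(1) fin B(1) B(3)[rule_format]]) (rule indep)
  thus ?thesis unfolding B(2) .
qed

lemma has_codimension_spanning_ge:
  fixes A :: "'k::field poly set"
  assumes A: "poly_subalgebra A" "has_codimension A n" and fin: "finite J"
    and span: "\<And>f. \<exists>c. f - (\<Sum>j\<in>J. smult (c j) (b j)) \<in> A"
  shows "n \<le> card J"
proof -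
  from A(2) obtain B where B: "finite B" "card B = n"
    "\<forall>c. (\<Sum>b\<in>B. smult (c b) b) \<in> A \<longrightarrow> (\<forall>b\<in>B. c b = 0)" by (rule has_codimensionE)
  have "card B \<le> card J"
    by (rule independent_mod_card_le_spanning_mod[OF A(1) B(1) fin span])
      (rule B(3)[rule_format])
  thus ?thesis unfolding B(2) .
qed

text \<open>
  The polynomials \<open>e z\<close> are independent modulo \<open>A\<close>, since \<open>\<phi> z\<close> reads off the coefficient of
  \<open>e z\<close> in any combination. If their number is the codimension, a common zero \<open>f\<close> of the
  functionals outside \<open>A\<close> could be added to the family, which would then have one independent
  member too many.
\<close>

lemma dual_functionals_codimension:
  fixes A :: "'k::field poly set" and \<phi> :: "'i \<Rightarrow> 'k poly \<Rightarrow> 'k"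
  assumes A: "poly_subalgebra A" "has_codimension A n" and fin: "finite Z"
    and add: "\<And>z f g. \<phi> z (f + g) = \<phi> z f + \<phi> z g"
    and scale: "\<And>z c f. \<phi> z (smult c f) = c * \<phi> z f"
    and vanish: "\<And>z f. z \<in> Z \<Longrightarrow> f \<in> A \<Longrightarrow> \<phi> z f = 0"
    and dual: "\<And>z y. z \<in> Z \<Longrightarrow> y \<in> Z \<Longrightarrow> \<phi> z (e y) = (if z = y then 1 else 0)"
  shows "card Z \<le> n"
    and "card Z = n \<Longrightarrow> A = {f. \<forall>z\<in>Z. \<phi> z f = 0}"
proof -
  have zero: "\<phi> z 0 = 0" for z using scale[of z 0 0] by simp
  have phi_sum: "\<phi> z (\<Sum>y\<in>Y. h y) = (\<Sum>y\<in>Y. \<phi> z (h y))" for z h and Y :: "'i set"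
    by (induction Y rule: infinite_finite_induct) (auto simp: add zero)
  have phi_comb: "\<phi> z (\<Sum>y\<in>Z. smult (c y) (e y)) = c z" if "z \<in> Z" for z c
  proof -
    have "\<phi> z (\<Sum>y\<in>Z. smult (c y) (e y)) = (\<Sum>y\<in>Z. if z = y then c y else 0)"
      unfolding phi_sum by (intro sum.cong) (auto simp: scale dual that)
    thus ?thesis using that fin by simp
  qed
  show "card Z \<le> n"
  proof (rule has_codimension_independent_le[OF A fin])
    fix c z assume "(\<Sum>y\<in>Z. smult (c y) (e y)) \<in> A" "z \<in> Z"
    thus "c z = 0" using vanish[of z "\<Sum>y\<in>Z. smult (c y) (e y)"] phi_comb[of z c] by simp
  qed
  show "A = {f. \<forall>z\<in>Z. \<phi> z f = 0}" if card: "card Z = n"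
  proof (intro equalityI subsetI CollectI ballI)
    fix f assume "f \<in> {f. \<forall>z\<in>Z. \<phi> z f = 0}"
    hence f: "\<And>z. z \<in> Z \<Longrightarrow> \<phi> z f = 0" by blast
    show "f \<in> A"
    proof (rule ccontr)
      assume nf: "f \<notin> A"
      \<comment> \<open>The index \<open>None\<close> stands for the additional member \<open>f\<close> of the family.\<close>
      define e' where "e' i = (case i of None \<Rightarrow> f | Some z \<Rightarrow> e z)" for i
      have "card (insert None (Some ` Z)) \<le> n"
      proof (rule has_codimension_independent_le[OF A])
        fix c i assume "(\<Sum>i\<in>insert None (Some ` Z). smult (c i) (e' i)) \<in> A"
          and i: "i \<in> insert None (Some ` Z)"
        hence mem: "smult (c None) f + (\<Sum>z\<in>Z. smult (c (Some z)) (e z)) \<in> A"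
          using fin by (simp add: e'_def sum.reindex)
        have cz: "c (Some z) = 0" if "z \<in> Z" for z
          using vanish[OF that mem] phi_comb[OF that, of "\<lambda>z. c (Some z)"] f[OF that]
          by (simp add: add scale)
        hence mem': "smult (c None) f \<in> A" using mem by simp
        have "c None = 0"
        proof (rule ccontr)
          assume "c None \<noteq> 0"
          hence "f = smult (inverse (c None)) (smult (c None) f)" by simp
          thus False using subalgebra_smult[OF A(1) mem', of "inverse (c None)"] nf by simp
        qed
        thus "c i = 0" using cz i by auto
      qed (use fin in auto)
      thus False using card fin by (simp add: card_image)
    qed
  qed (use vanish in auto)
qed

section \<open>Point evaluations and derivatives\<close>

text \<open>
  Induction on the points: the square of the product of the linear factors of the old points
  vanishes to second order there, so a linear polynomial times this square can correct the value
  and the derivative at the new point.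
\<close>

lemma hermite_interpolation:
  fixes v w :: "'k::field \<Rightarrow> 'k"
  assumes "finite X"
  shows "\<exists>f. \<forall>x\<in>X. poly f x = v x \<and> poly (pderiv f) x = w x"
  using assms
proof (induction X rule: finite_induct)
  case (insert a X)
  then obtain f where f: "\<And>x. x \<in> X \<Longrightarrow> poly f x = v x \<and> poly (pderiv f) x = w x" by blast
  define k where "k = (\<Prod>x\<in>X. [:-x, 1:])"
  define h where "h = k * k"
  have k0: "poly k x = 0" if "x \<in> X" for x
    using insert(1) that by (auto simp: k_def poly_prod)
  have "poly k a \<noteq> 0"
    using insert(1,2) by (auto simp: k_def poly_prod)
  hence ha: "poly h a \<noteq> 0" by (simp add: h_def)
  have hX: "poly h x = 0" "poly (pderiv h) x = 0" if "x \<in> X" for x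
    using k0[OF that] by (auto simp: h_def pderiv_mult)
  define c where "c = (v a - poly f a) / poly h a"
  define d where "d = (w a - poly (pderiv f) a - poly (pderiv h) a * c) / poly h a"
  define F where "F = f + h * ([:c:] + [:d:] * [:-a, 1:])"
  have "poly F a = poly f a + poly h a * c" by (simp add: F_def algebra_simps)
  hence "poly F a = v a" using ha by (simp add: c_def)
  moreover have "poly (pderiv F) a = poly (pderiv f) a + poly (pderiv h) a * c + poly h a * d"
    by (simp add: F_def pderiv_add pderiv_mult pderiv_smult pderiv_pCons algebra_simps)
  hence "poly (pderiv F) a = w a" using ha by (simp add: d_def)
  moreover have "poly F x = v x \<and> poly (pderiv F) x = w x" if "x \<in> X" for x
    using f[OF that] hX[OF that] by (simp add: F_def pderiv_add pderiv_mult pderiv_smult pderiv_pCons)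
  ultimately show ?case by blast
qed auto

text \<open>
  Interpolation provides the polynomials dual to the functionals. The image \<open>s z\<close> must avoid \<open>P\<close>
  for this: the polynomial dual to the condition at \<open>z\<close> takes the value 1 at \<open>z\<close> and 0 at
  \<open>s z\<close>, and must not violate any other condition. So \<open>s\<close> may be thought of as picking a
  representative in each class of points with equal values, and \<open>P\<close> as consisting of
  points that are not representatives.
\<close>

lemma point_conditions_codimension:
  fixes A :: "'k::field poly set"
  assumes A: "poly_subalgebra A" "has_codimension A n"
    and fin: "finite P" "finite Q" and disj: "P \<inter> Q = {}"
    and s_out: "\<And>z. z \<in> P \<Longrightarrow> s z \<notin> P"
    and glued: "\<And>z f. z \<in> P \<Longrightarrow> f \<in> A \<Longrightarrow> poly f z = poly f (s z)"
    and crit: "\<And>z f. z \<in> Q \<Longrightarrow> f \<in> A \<Longrightarrow> poly (pderiv f) z = 0"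
  shows "card (P \<union> Q) \<le> n"
    and "card (P \<union> Q) = n \<Longrightarrow>
           A = {f. (\<forall>z\<in>P. poly f z = poly f (s z)) \<and> (\<forall>z\<in>Q. poly (pderiv f) z = 0)}"
proof -
  define \<phi> where "\<phi> z f = (if z \<in> Q then poly (pderiv f) z else poly f z - poly f (s z))" for z f
  have "\<forall>y. \<exists>e. \<forall>x\<in>P \<union> Q \<union> s ` P. poly e x = (if x = y \<and> y \<in> P then 1 else 0) \<and>
          poly (pderiv e) x = (if x = y \<and> y \<in> Q then 1 else 0)"
    using fin by (intro allI hermite_interpolation) auto
  from choice[OF this] obtain e where e_all: "\<forall>y. \<forall>x\<in>P \<union> Q \<union> s ` P.
      poly (e y) x = (if x = y \<and> y \<in> P then 1 else 0) \<and>
      poly (pderiv (e y)) x = (if x = y \<and> y \<in> Q then 1 else 0)" ..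
  note e = e_all[rule_format]
  have dual: "\<phi> z (e y) = (if z = y then 1 else 0)" if "z \<in> P \<union> Q" "y \<in> P \<union> Q" for z y
  proof (cases "z \<in> Q")
    case True
    thus ?thesis using e[of z y] that by (auto simp: \<phi>_def)
  next
    case False
    hence "z \<in> P" using that by blast
    thus ?thesis using e[of z y] e[of "s z" y] that s_out[of z] False by (auto simp: \<phi>_def)
  qed
  note * = dual_functionals_codimension[of A n "P \<union> Q" \<phi> e, OF A _ _ _ _ dual]
  show "card (P \<union> Q) \<le> n"
    using fin glued crit
    by (intro *) (auto simp: \<phi>_def pderiv_add pderiv_smult algebra_simps)
  assume "card (P \<union> Q) = n"
  hence "A = {f. \<forall>z\<in>P \<union> Q. \<phi> z f = 0}"
    using fin glued crit
    by (intro *) (auto simp: \<phi>_def pderiv_add pderiv_smult algebra_simps)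
  also have "\<dots> = {f. (\<forall>z\<in>P. poly f z = poly f (s z)) \<and> (\<forall>z\<in>Q. poly (pderiv f) z = 0)}"
    using disj by (auto simp: \<phi>_def)
  finally show "A = \<dots>" .
qed

section \<open>Degree semigroups and their gaps\<close>

definition indecomposables :: "nat set \<Rightarrow> nat set" where
  "indecomposables S = {s \<in> S. \<forall>m\<in>S. \<forall>n\<in>S. s \<noteq> m + n}"

lemma semigroup_gen_subset:
  assumes "D \<subseteq> S" "\<And>m n. m \<in> S \<Longrightarrow> n \<in> S \<Longrightarrow> m + n \<in> S"
  shows "semigroup_gen D \<subseteq> S"
proof
  fix x assume "x \<in> semigroup_gen D"
  thus "x \<in> S" by induction (use assms in auto)
qed

lemma indecomposables_generate:
  assumes "0 \<notin> S"
  shows "S \<subseteq> semigroup_gen (indecomposables S)"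
proof
  fix s assume "s \<in> S"
  thus "s \<in> semigroup_gen (indecomposables S)"
  proof (induction s rule: less_induct)
    case (less s)
    show ?case
    proof (cases "s \<in> indecomposables S")
      case True
      thus ?thesis by (rule semigroup_gen.base)
    next
      case False
      then obtain m n where mn: "m \<in> S" "n \<in> S" "s = m + n"
        using less.prems unfolding indecomposables_def by blast
      have "m \<noteq> 0" "n \<noteq> 0" using mn assms by metis+
      hence "m < s" "n < s" using mn(3) by simp_all
      hence "m + n \<in> semigroup_gen (indecomposables S)"
        using mn by (intro semigroup_gen.add less.IH)
      thus ?thesis using mn(3) by simp
    qed
  qed
qed

text \<open>
  The summands of an element of \<open>S\<close> are smaller than the element, as all members of \<open>S\<close> are
  positive. So \<open>s\<close> is generated by the other elements precisely if it is a sum of two elements.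
\<close>

lemma minimal_generators_eq_indecomposables:
  assumes zero: "0 \<notin> S" and closed: "\<And>m n. m \<in> S \<Longrightarrow> n \<in> S \<Longrightarrow> m + n \<in> S"
  shows "minimal_generators S = indecomposables S"
proof (intro equalityI subsetI)
  fix s assume s: "s \<in> minimal_generators S"
  hence sS: "s \<in> S" and ngen: "s \<notin> semigroup_gen (S - {s})"
    by (auto simp: minimal_generators_def)
  have "s \<noteq> m + n" if mn: "m \<in> S" "n \<in> S" for m n
  proof
    assume eq: "s = m + n"
    have "m \<noteq> 0" "n \<noteq> 0" using mn zero by metis+
    hence "m \<in> S - {s}" "n \<in> S - {s}" using mn eq by auto
    hence "s \<in> semigroup_gen (S - {s})"
      unfolding eq by (intro semigroup_gen.add semigroup_gen.base)
    with ngen show False ..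
  qed
  thus "s \<in> indecomposables S" using sS by (auto simp: indecomposables_def)
next
  fix s assume s: "s \<in> indecomposables S"
  hence sS: "s \<in> S" and nsum: "\<And>m n. m \<in> S \<Longrightarrow> n \<in> S \<Longrightarrow> s \<noteq> m + n"
    by (auto simp: indecomposables_def)
  have sub: "semigroup_gen (S - {s}) \<subseteq> S"
    by (rule semigroup_gen_subset) (auto intro: closed)
  have "s \<notin> semigroup_gen (S - {s})"
  proof
    assume "s \<in> semigroup_gen (S - {s})"
    thus False using nsum sub by cases auto
  qed
  thus "s \<in> minimal_generators S" using sS by (simp add: minimal_generators_def)
qed

lemma degree_semigroup_add:
  assumes "poly_subalgebra A" "m \<in> degree_semigroup A" "n \<in> degree_semigroup A"
  shows "m + n \<in> degree_semigroup A"
proof -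
  from assms(2,3) obtain f h where fh: "f \<in> A" "h \<in> A" "degree f = m" "degree h = n" "m > 0" "n > 0"
    by (auto simp: degree_semigroup_def)
  hence "f \<noteq> 0" "h \<noteq> 0" by auto
  hence "degree (f * h) = m + n" using fh by (simp add: degree_mult_eq)
  moreover have "f * h \<in> A" using fh assms(1) by (simp add: poly_subalgebra_def)
  ultimately show ?thesis using fh(5)
    unfolding degree_semigroup_def by (intro CollectI exI[of _ "f * h"]) simp
qed

lemma degree_le_pred:
  assumes "degree f \<le> Suc k" "coeff f (Suc k) = 0"
  shows "degree f \<le> k"
proof (rule ccontr)
  assume "\<not> degree f \<le> k"
  hence deg: "degree f = Suc k" using assms(1) by simp
  hence "lead_coeff f = 0" using assms(2) by (simp only:)
  hence "f = 0" by (simp only: leading_coeff_0_iff)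
  thus False using deg by simp
qed

text \<open>
  Division with remainder by leading terms: if the degree \<open>n\<close> of \<open>f\<close> occurs in \<open>A\<close>, subtract a
  multiple of an element of \<open>A\<close> of this degree, and otherwise a multiple of the monomial of
  degree \<open>n\<close>. The constants that remain in the end lie in \<open>A\<close>.
\<close>

lemma monomials_span_mod:
  fixes A :: "'k::field poly set"
  assumes A: "poly_subalgebra A" and fin: "finite N"
    and nongap: "\<And>n. 0 < n \<Longrightarrow> n \<notin> N \<Longrightarrow> n \<in> degree_semigroup A"
  shows "\<exists>c. f - (\<Sum>n\<in>N. smult (c n) (monom 1 n)) \<in> A"
proof -
  have "degree f \<le> k \<Longrightarrow> ?thesis" for k
  proof (induction k arbitrary: f)
    case 0
    hence "degree f = 0" by simp
    then obtain a where "f = [:a:]" by (rule degree_eq_zeroE)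
    hence "f - (\<Sum>n\<in>N. smult 0 (monom 1 n)) \<in> A" using subalgebra_const[OF A] by simp
    thus ?case by (rule exI[where x = "\<lambda>_. 0"])
  next
    case (Suc k)
    show ?case
    proof (cases "Suc k \<in> N")
      case True
      define a where "a = coeff f (Suc k)"
      have "degree (f - monom a (Suc k)) \<le> k"
        using Suc.prems degree_monom_le[of a "Suc k"]
        by (intro degree_le_pred[OF degree_diff_le]) (auto simp: a_def)
      from Suc.IH[OF this] obtain c
        where c: "f - monom a (Suc k) - (\<Sum>n\<in>N. smult (c n) (monom 1 n)) \<in> A" ..
      define c' where "c' n = c n + (if n = Suc k then a else 0)" for n
      have "(\<Sum>n\<in>N. smult (c' n) (monom 1 n)) =
          (\<Sum>n\<in>N. smult (c n) (monom 1 n)) + (\<Sum>n\<in>N. if n = Suc k then monom a n else 0)"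
        unfolding sum.distrib[symmetric]
        by (intro sum.cong) (auto simp: c'_def smult_add_left smult_monom add_monom)
      also have "\<dots> = (\<Sum>n\<in>N. smult (c n) (monom 1 n)) + monom a (Suc k)"
        using fin True by simp
      finally have "f - (\<Sum>n\<in>N. smult (c' n) (monom 1 n)) \<in> A"
        using c by (simp add: algebra_simps)
      thus ?thesis by (rule exI[where x = c'])
    next
      case False
      then obtain h where h: "h \<in> A" "degree h = Suc k"
        using nongap[of "Suc k"] by (auto simp: degree_semigroup_def)
      define a where "a = coeff f (Suc k) / lead_coeff h"
      have "h \<noteq> 0" using h by auto
      hence "degree (f - smult a h) \<le> k"
        using Suc.prems degree_smult_le[of a h] h(2) leading_coeff_0_iff[of h]
        by (intro degree_le_pred[OF degree_diff_le]) (auto simp: a_def)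
      from Suc.IH[OF this] obtain c
        where c: "f - smult a h - (\<Sum>n\<in>N. smult (c n) (monom 1 n)) \<in> A" ..
      have "f - (\<Sum>n\<in>N. smult (c n) (monom 1 n)) =
          (f - smult a h - (\<Sum>n\<in>N. smult (c n) (monom 1 n))) + smult a h" by simp
      also have "\<dots> \<in> A" using subalgebra_add[OF A c subalgebra_smult[OF A h(1)]] .
      finally show ?thesis by (rule exI[where x = c])
    qed
  qed
  thus ?thesis by blast
qed

text \<open>
  If some \<open>d \<in> N\<close> were a degree, then the monomials with exponents in \<open>N - {d}\<close> would span the
  quotient space, and there are too few of them.
\<close>

lemma gaps_eq_if_card_eq_codimension:
  fixes A :: "'k::field poly set"
  assumes A: "poly_subalgebra A" "has_codimension A (card N)" and fin: "finite N"
    and nongap: "{n. 0 < n \<and> n \<notin> N} \<subseteq> degree_semigroup A"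
  shows "degree_semigroup A = {n. 0 < n \<and> n \<notin> N}"
proof (rule ccontr)
  assume "degree_semigroup A \<noteq> {n. 0 < n \<and> n \<notin> N}"
  then obtain d where d: "d \<in> degree_semigroup A" "d \<in> N"
    using nongap by (auto simp: degree_semigroup_def)
  have "card N \<le> card (N - {d})"
  proof (rule has_codimension_spanning_ge[OF A])
    fix f show "\<exists>c. f - (\<Sum>n\<in>N - {d}. smult (c n) (monom 1 n)) \<in> A"
      using nongap d fin by (intro monomials_span_mod[OF A(1)]) auto
  qed (use fin in auto)
  thus False using card_Diff1_less[OF fin d(2)] by simp
qed

text \<open>
  The indecomposable non-gaps generate all non-gaps, so only finitely many degrees have to be
  exhibited. Everything about \<open>A\<close> beyond the membership of \<open>G\<close> enters through its codimension,
  which forbids further degrees.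
\<close>

lemma SAGBI_basis_and_type_by_gaps:
  fixes A :: "'k::field poly set"
  assumes A: "poly_subalgebra A" "has_codimension A (card N)" and fin: "finite N"
    and G: "finite G" "G \<subseteq> A"
    and deg: "degree ` G = indecomposables {n. 0 < n \<and> n \<notin> N}"
  shows "subalgebra_type A = sorted_list_of_set (degree ` G) \<and> SAGBI_basis A G"
proof -
  let ?S = "{n. 0 < n \<and> n \<notin> N}"
  have pos: "\<forall>g\<in>G. degree g > 0"
  proof
    fix g assume "g \<in> G"
    hence "degree g \<in> degree ` G" by (rule imageI)
    thus "degree g > 0" unfolding deg by (simp add: indecomposables_def)
  qed
  have "degree ` G \<subseteq> degree_semigroup A"
    using G pos by (auto simp: degree_semigroup_def)
  hence gen_sub: "semigroup_gen (degree ` G) \<subseteq> degree_semigroup A"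
    by (rule semigroup_gen_subset) (rule degree_semigroup_add[OF A(1)])
  have S_gen: "?S \<subseteq> semigroup_gen (degree ` G)"
    unfolding deg by (rule indecomposables_generate) simp
  have S: "degree_semigroup A = ?S"
    using gen_sub S_gen by (intro gaps_eq_if_card_eq_codimension[OF A fin]) blast
  have "SAGBI_basis A G"
    unfolding SAGBI_basis_def using G pos gen_sub S_gen S by auto
  moreover have "minimal_generators ?S = indecomposables ?S"
    using degree_semigroup_add[OF A(1)] unfolding S
    by (intro minimal_generators_eq_indecomposables) simp_all
  hence "subalgebra_type A = sorted_list_of_set (degree ` G)"
    unfolding subalgebra_type_def S deg by simp
  ultimately show ?thesis by blast
qed

lemma indecomposables_eqI:
  assumes "D \<subseteq> indecomposables S"
    and "\<And>s. s \<in> S \<Longrightarrow> s \<notin> D \<Longrightarrow> \<exists>m\<in>S. m \<le> s \<and> s - m \<in> S"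
  shows "indecomposables S = D"
proof (intro equalityI subsetI)
  fix s assume s: "s \<in> indecomposables S"
  show "s \<in> D"
  proof (rule ccontr)
    assume "s \<notin> D"
    moreover have "s \<in> S" using s by (simp add: indecomposables_def)
    ultimately obtain m where "m \<in> S" "m \<le> s" "s - m \<in> S"
      using assms(2) by blast
    moreover have "s = m + (s - m)" using \<open>m \<le> s\<close> by simp
    ultimately show False using s by (simp add: indecomposables_def)
  qed
qed (use assms(1) in auto)

text \<open>
  In each of the four semigroups the elements that are not listed decompose with one summand
  equal to the smallest element, except that \<open>8 = 4 + 4\<close> in the semigroup with gaps \<open>1, 2, 5\<close>.
\<close>

lemma indecomposables_gaps_123: "indecomposables {n. 0 < n \<and> n \<notin> {1, 2, 3}} = {4, 5, 6, 7}"
proof (rule indecomposables_eqI)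
  fix s :: nat assume "s \<in> {n. 0 < n \<and> n \<notin> {1, 2, 3}}" "s \<notin> {4, 5, 6, 7}"
  thus "\<exists>m\<in>{n. 0 < n \<and> n \<notin> {1, 2, 3}}. m \<le> s \<and> s - m \<in> {n. 0 < n \<and> n \<notin> {1, 2, 3}}"
    by (intro bexI[of _ "4"]) auto
qed (auto simp: indecomposables_def)

lemma indecomposables_gaps_124: "indecomposables {n. 0 < n \<and> n \<notin> {1, 2, 4}} = {3, 5, 7}"
proof (rule indecomposables_eqI)
  fix s :: nat assume "s \<in> {n. 0 < n \<and> n \<notin> {1, 2, 4}}" "s \<notin> {3, 5, 7}"
  thus "\<exists>m\<in>{n. 0 < n \<and> n \<notin> {1, 2, 4}}. m \<le> s \<and> s - m \<in> {n. 0 < n \<and> n \<notin> {1, 2, 4}}"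
    by (intro bexI[of _ "3"]) auto
qed (auto simp: indecomposables_def)

lemma indecomposables_gaps_125: "indecomposables {n. 0 < n \<and> n \<notin> {1, 2, 5}} = {3, 4}"
proof (rule indecomposables_eqI)
  fix s :: nat assume "s \<in> {n. 0 < n \<and> n \<notin> {1, 2, 5}}" "s \<notin> {3, 4}"
  thus "\<exists>m\<in>{n. 0 < n \<and> n \<notin> {1, 2, 5}}. m \<le> s \<and> s - m \<in> {n. 0 < n \<and> n \<notin> {1, 2, 5}}"
    by (intro bexI[of _ "if s = 8 then 4 else 3"]) auto
qed (auto simp: indecomposables_def)

lemma indecomposables_gaps_135: "indecomposables {n. 0 < n \<and> n \<notin> {1, 3, 5}} = {2, 7}"
proof (rule indecomposables_eqI)
  fix s :: nat assume "s \<in> {n. 0 < n \<and> n \<notin> {1, 3, 5}}" "s \<notin> {2, 7}"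
  thus "\<exists>m\<in>{n. 0 < n \<and> n \<notin> {1, 3, 5}}. m \<le> s \<and> s - m \<in> {n. 0 < n \<and> n \<notin> {1, 3, 5}}"
    by (intro bexI[of _ "2"]) auto
qed (auto simp: indecomposables_def)

lemma SAGBI_degrees_4567:
  assumes "poly_subalgebra A" "has_codimension A 3"
    and "a \<in> A" "b \<in> A" "c \<in> A" "d \<in> A" "degree a = 4" "degree b = 5" "degree c = 6" "degree d = 7"
  shows "subalgebra_type A = [4, 5, 6, 7] \<and> SAGBI_basis A {a, b, c, d}"
  using SAGBI_basis_and_type_by_gaps[of A "{1, 2, 3}" "{a, b, c, d}"] assms
  by (simp only: indecomposables_gaps_123) (simp add: numeral_3_eq_3)

lemma SAGBI_degrees_357:
  assumes "poly_subalgebra A" "has_codimension A 3"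
    and "a \<in> A" "b \<in> A" "c \<in> A" "degree a = 3" "degree b = 5" "degree c = 7"
  shows "subalgebra_type A = [3, 5, 7] \<and> SAGBI_basis A {a, b, c}"
  using SAGBI_basis_and_type_by_gaps[of A "{1, 2, 4}" "{a, b, c}"] assms
  by (simp only: indecomposables_gaps_124) (simp add: numeral_3_eq_3)

lemma SAGBI_degrees_34:
  assumes "poly_subalgebra A" "has_codimension A 3"
    and "a \<in> A" "b \<in> A" "degree a = 3" "degree b = 4"
  shows "subalgebra_type A = [3, 4] \<and> SAGBI_basis A {a, b}"
  using SAGBI_basis_and_type_by_gaps[of A "{1, 2, 5}" "{a, b}"] assms
  by (simp only: indecomposables_gaps_125) (simp add: numeral_3_eq_3)

lemma SAGBI_degrees_27:
  assumes "poly_subalgebra A" "has_codimension A 3"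
    and "a \<in> A" "b \<in> A" "degree a = 2" "degree b = 7"
  shows "subalgebra_type A = [2, 7] \<and> SAGBI_basis A {a, b}"
  using SAGBI_basis_and_type_by_gaps[of A "{1, 3, 5}" "{a, b}"] assms
  by (simp only: indecomposables_gaps_135) (simp add: numeral_3_eq_3)

section \<open>Five spectral elements\<close>

text \<open>
  Let \<open>P\<close> be the set of spectral points that do not represent their class of points with equal
  values, and \<open>Q\<close> the set of representatives at which all derivatives vanish. The conditions
  at these points are independent, so there are at most three of them and at least two of the five
  points remain. Each remaining point represents a class that contains a further point. This gives
  the two pairs, which lie in different classes. If the fifth point belongs to the class of the
  second pair, the two pairs are exchanged.
\<close>

lemma five_spectral_points_cases:
  fixes A :: "'k::field poly set"
  assumes A: "poly_subalgebra A" "has_codimension A 3" and card5: "card (spectrum A) = 5"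
  obtains \<alpha> \<beta> \<gamma> \<delta> \<mu> where "distinct [\<alpha>, \<beta>, \<gamma>, \<delta>, \<mu>]" "spectrum A = {\<alpha>, \<beta>, \<gamma>, \<delta>, \<mu>}"
    "\<forall>f\<in>A. poly f \<alpha> = poly f \<beta>" "\<forall>f\<in>A. poly f \<gamma> = poly f \<delta>"
    "(\<forall>f\<in>A. poly f \<alpha> = poly f \<mu>) \<or> (\<forall>f\<in>A. poly (pderiv f) \<mu> = 0)"
proof -
  let ?Sp = "spectrum A"
  define glued where "glued x y \<longleftrightarrow> (\<forall>f\<in>A. poly f x = poly f y)" for x y
  \<comment> \<open>Glued points satisfy the same predicate \<open>glued x\<close>, so they get the same representative.\<close>
  define s where "s x = (SOME y. glued x y)" for x
  have glued_sym: "glued y x" if "glued x y" for x y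
    using that by (simp add: glued_def)
  have glued_trans: "glued x z" if "glued x y" "glued y z" for x y z
    using that by (simp add: glued_def)
  have "glued x x" for x by (simp add: glued_def)
  hence glued_s: "glued x (s x)" for x unfolding s_def by (rule someI)
  have s_eq: "s x = s y" if "glued x y" for x y
  proof -
    have "glued x = glued y"
      using that by (intro ext) (auto simp: glued_def)
    thus ?thesis by (simp add: s_def)
  qed
  have s_s: "s (s x) = s x" for x using s_eq[OF glued_s] by simp
  have in_spectrum: "x \<in> ?Sp" if "glued x y" "y \<noteq> x" for x y
    using that by (auto simp: spectrum_def glued_def)
  have fin: "finite ?Sp" using card5 card.infinite by fastforce
  define P where "P = {x \<in> ?Sp. s x \<noteq> x}"
  define Q where "Q = {x \<in> ?Sp. s x = x \<and> (\<forall>f\<in>A. poly (pderiv f) x = 0)}"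
  have "card (P \<union> Q) \<le> 3"
  proof (rule point_conditions_codimension(1)[OF A])
    show "finite P" "finite Q" "P \<inter> Q = {}" using fin by (auto simp: P_def Q_def)
    show "s z \<notin> P" for z by (simp add: P_def s_s)
    show "poly f z = poly f (s z)" if "f \<in> A" for z f
      using glued_s[of z] that by (simp add: glued_def)
    show "poly (pderiv f) z = 0" if "z \<in> Q" "f \<in> A" for z f
      using that by (simp add: Q_def)
  qed
  moreover have PQ: "P \<union> Q \<subseteq> ?Sp" by (auto simp: P_def Q_def)
  have "card (?Sp - (P \<union> Q)) = 5 - card (P \<union> Q)"
    using card_Diff_subset[OF finite_subset[OF PQ fin] PQ] card5 by simp
  ultimately have "2 \<le> card (?Sp - (P \<union> Q))" by simp
  then obtain T where "T \<subseteq> ?Sp - (P \<union> Q)" "card T = 2"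
    by (rule obtain_subset_with_card_n)
  then obtain a c where ac: "a \<in> ?Sp - (P \<union> Q)" "c \<in> ?Sp - (P \<union> Q)" "a \<noteq> c"
    by (auto simp: card_2_iff)
  have rep: "s x = x" if "x \<in> ?Sp - (P \<union> Q)" for x using that by (auto simp: P_def)
  have partner: "\<exists>y. y \<noteq> x \<and> glued x y" if "x \<in> ?Sp - (P \<union> Q)" for x
    using that by (auto simp: P_def Q_def spectrum_def glued_def)
  obtain b where b: "b \<noteq> a" "glued a b" using partner[OF ac(1)] by blast
  obtain d where d: "d \<noteq> c" "glued c d" using partner[OF ac(2)] by blast
  have "\<not> glued a c" using s_eq[of a c] rep ac by auto
  hence diff: "b \<noteq> c" "b \<noteq> d" "a \<noteq> d"
    using b d glued_sym glued_trans by blast+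
  have sub: "{a, b, c, d} \<subseteq> ?Sp"
    using in_spectrum b d glued_sym by blast
  have "card {a, b, c, d} = 4" using b d diff ac(3) by simp
  hence "card (?Sp - {a, b, c, d}) = 1"
    using card5 sub by (simp add: card_Diff_subset)
  then obtain m where m: "?Sp - {a, b, c, d} = {m}" by (auto simp: card_1_singleton_iff)
  hence Sp: "?Sp = {a, b, c, d, m}" and m_new: "m \<notin> {a, b, c, d}" and m_Sp: "m \<in> ?Sp"
    using sub by blast+
  consider "\<forall>f\<in>A. poly (pderiv f) m = 0" | "glued a m" | "glued c m"
  proof -
    from m_Sp have "(\<forall>f\<in>A. poly (pderiv f) m = 0) \<or> (\<exists>y. y \<noteq> m \<and> glued m y)"
      by (auto simp: spectrum_def glued_def)
    moreover have "glued a m \<or> glued c m" if y: "y \<noteq> m" "glued m y" for y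
    proof -
      have "y \<in> ?Sp" using in_spectrum[OF glued_sym[OF y(2)]] y(1) by blast
      hence "y = a \<or> y = b \<or> y = c \<or> y = d" using Sp y(1) by blast
      thus ?thesis using glued_sym[OF y(2)] b(2) d(2) glued_trans by blast
    qed
    ultimately show ?thesis using that by blast
  qed
  thus ?thesis
  proof cases
    case 1
    show ?thesis
      by (rule that[of a b c d m]) (use 1 b d ac(3) diff m_new Sp in \<open>auto simp: glued_def\<close>)
  next
    case 2
    show ?thesis
      by (rule that[of a b c d m]) (use 2 b d ac(3) diff m_new Sp in \<open>auto simp: glued_def\<close>)
  next
    case 3
    show ?thesis
      by (rule that[of c d a b m]) (use 3 b d ac(3) diff m_new Sp in \<open>auto simp: glued_def\<close>)
  qed
qed

lemma glued_triple_and_pair_determine: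
  fixes A :: "'k::field poly set"
  assumes A: "poly_subalgebra A" "has_codimension A 3"
    and dist: "distinct [\<alpha>, \<beta>, \<gamma>, \<delta>, \<mu>]"
    and glued: "\<forall>f\<in>A. poly f \<alpha> = poly f \<beta>" "\<forall>f\<in>A. poly f \<gamma> = poly f \<delta>" "\<forall>f\<in>A. poly f \<alpha> = poly f \<mu>"
  shows "A = {f. poly f \<alpha> = poly f \<beta> \<and> poly f \<beta> = poly f \<mu> \<and> poly f \<gamma> = poly f \<delta>}"
proof -
  define s where "s z = (if z = \<delta> then \<gamma> else \<alpha>)" for z
  have "A = {f. (\<forall>z\<in>{\<beta>, \<mu>, \<delta>}. poly f z = poly f (s z)) \<and> (\<forall>z\<in>{}. poly (pderiv f) z = 0)}"
    using dist glued
    by (intro point_conditions_codimension(2)[OF A]) (auto simp: s_def)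
  also have "\<dots> = {f. poly f \<alpha> = poly f \<beta> \<and> poly f \<beta> = poly f \<mu> \<and> poly f \<gamma> = poly f \<delta>}"
    using dist by (auto simp: s_def)
  finally show ?thesis .
qed

lemma glued_pairs_and_critical_point_determine:
  fixes A :: "'k::field poly set"
  assumes A: "poly_subalgebra A" "has_codimension A 3"
    and dist: "distinct [\<alpha>, \<beta>, \<gamma>, \<delta>, \<mu>]"
    and glued: "\<forall>f\<in>A. poly f \<alpha> = poly f \<beta>" "\<forall>f\<in>A. poly f \<gamma> = poly f \<delta>"
    and crit: "\<forall>f\<in>A. poly (pderiv f) \<mu> = 0"
  shows "A = {f. poly f \<alpha> = poly f \<beta> \<and> poly f \<gamma> = poly f \<delta> \<and> poly (pderiv f) \<mu> = 0}"
proof -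
  define s where "s z = (if z = \<delta> then \<gamma> else \<alpha>)" for z
  have "A = {f. (\<forall>z\<in>{\<beta>, \<delta>}. poly f z = poly f (s z)) \<and> (\<forall>z\<in>{\<mu>}. poly (pderiv f) z = 0)}"
    using dist glued crit
    by (intro point_conditions_codimension(2)[OF A]) (auto simp: s_def)
  also have "\<dots> = {f. poly f \<alpha> = poly f \<beta> \<and> poly f \<gamma> = poly f \<delta> \<and> poly (pderiv f) \<mu> = 0}"
    using dist by (auto simp: s_def)
  finally show ?thesis .
qed

section \<open>Polynomials of prescribed degree\<close>

lemma degree_smult_diff_dominant:
  fixes f h :: "'k::field poly"
  assumes "degree f < degree h" "b \<noteq> 0"
  shows "degree (smult a f - smult b h) = degree h" "degree (smult b h - smult a f) = degree h"
proof -
  have "degree (smult a f) < degree (smult b h)"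
    using assms le_less_trans[OF degree_smult_le] by simp
  hence "degree (smult a f + (- smult b h)) = degree h"
    by (subst degree_add_eq_right) (use assms in simp_all)
  thus 1: "degree (smult a f - smult b h) = degree h" by simp
  have "smult b h - smult a f = - (smult a f - smult b h)" by simp
  thus "degree (smult b h - smult a f) = degree h" using 1 by (simp only: degree_minus)
qed

lemma degree_five_point_poly:
  "degree ([:-\<alpha>, 1:] * [:-\<beta>, 1:] * [:-\<gamma>, 1:] * [:-\<delta>, 1:] * [:-\<mu>, 1:] ^ i :: 'k::field poly) = 4 + i"
  by (simp add: degree_mult_eq degree_power_eq del: mult_pCons_left mult_pCons_right)

lemma poly_five_point_poly_eq_0_iff:
  "poly ([:-\<alpha>, 1:] * [:-\<beta>, 1:] * [:-\<gamma>, 1:] * [:-\<delta>, 1:] * [:-\<mu>, 1:] ^ i :: 'k::field poly) x = 0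
     \<longleftrightarrow> x = \<alpha> \<or> x = \<beta> \<or> x = \<gamma> \<or> x = \<delta> \<or> (i > 0 \<and> x = \<mu>)"
  by (auto simp del: mult_pCons_left mult_pCons_right)

text \<open>
  The centred square is symmetric about the midpoint of \<open>\<alpha>\<close> and \<open>\<beta>\<close>. So it takes equal values at
  \<open>\<alpha>\<close> and \<open>\<beta>\<close>, and at a second pair if and only if this pair has the same midpoint, which is the
  meaning of \<open>\<Delta> = 0\<close>.
\<close>

lemma centred_square_diff:
  fixes x y \<alpha> \<beta> :: "'k::field_char_0"
  shows "poly ([:- ((\<alpha> + \<beta>) / 2), 1:] ^ 2) x - poly ([:- ((\<alpha> + \<beta>) / 2), 1:] ^ 2) y
           = (x - y) * (x + y - \<alpha> - \<beta>)"
proof -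
  define m where "m = (\<alpha> + \<beta>) / 2"
  have "\<alpha> + \<beta> = 2 * m" by (simp add: m_def)
  hence "x + y - \<alpha> - \<beta> = x + y - 2 * m" by (simp add: diff_diff_add)
  thus ?thesis unfolding m_def[symmetric] by (simp add: power2_eq_square algebra_simps)
qed

lemma degree_centred_square: "degree ([:- c, 1:] ^ 2 :: 'k::field poly) = 2"
  by (simp add: degree_power_eq)

text \<open>
  The equation for equal values at \<open>\<gamma>\<close> and \<open>\<delta>\<close>, divided by \<open>\<gamma> - \<delta>\<close>, is linear in the third root
  \<open>\<tau>\<close>, and \<open>\<Delta>\<close> is the coefficient of \<open>\<tau>\<close>.
\<close>

lemma glued_cubic:
  fixes \<alpha> \<beta> \<gamma> \<delta> :: "'k::field"
  assumes "\<gamma> + \<delta> - \<alpha> - \<beta> \<noteq> 0"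
  defines "\<tau> \<equiv> (\<gamma>^2 + \<gamma> * \<delta> + \<delta>^2 + \<alpha> * \<beta> - (\<alpha> + \<beta>) * (\<gamma> + \<delta>)) / (\<gamma> + \<delta> - \<alpha> - \<beta>)"
  shows "poly ([:-\<alpha>, 1:] * [:-\<beta>, 1:] * [:-\<tau>, 1:]) \<gamma> = poly ([:-\<alpha>, 1:] * [:-\<beta>, 1:] * [:-\<tau>, 1:]) \<delta>"
proof -
  have \<tau>: "\<tau> * (\<gamma> + \<delta> - \<alpha> - \<beta>) = \<gamma>^2 + \<gamma> * \<delta> + \<delta>^2 + \<alpha> * \<beta> - (\<alpha> + \<beta>) * (\<gamma> + \<delta>)"
    using assms(1) by (simp add: \<tau>_def)
  have "(\<gamma> - \<alpha>) * (\<gamma> - \<beta>) * (\<gamma> - \<tau>) - (\<delta> - \<alpha>) * (\<delta> - \<beta>) * (\<delta> - \<tau>) = (\<gamma> - \<delta>) *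
      (\<gamma>^2 + \<gamma> * \<delta> + \<delta>^2 + \<alpha> * \<beta> - (\<alpha> + \<beta>) * (\<gamma> + \<delta>) - \<tau> * (\<gamma> + \<delta> - \<alpha> - \<beta>))"
    by (simp add: power2_eq_square algebra_simps)
  also have "\<dots> = 0" using \<tau> by simp
  finally show ?thesis by (simp del: mult_pCons_left mult_pCons_right)
qed

lemma degree_cubic: "degree ([:-a, 1:] * [:-b, 1:] * [:-c, 1:] :: 'k::field poly) = 3"
  by (simp add: degree_mult_eq del: mult_pCons_left mult_pCons_right)

section \<open>The two families\<close>

text \<open>
  The polynomials \<open>p i\<close> with \<open>i > 0\<close> vanish at all five points and hence lie in \<open>A\<close>; \<open>p 0\<close> and,
  depending on \<open>\<Delta>\<close>, either \<open>g\<close> or \<open>q\<close> satisfy the conditions for both pairs and can fail the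
  definition of \<open>A\<close> only through \<open>L\<close>. For two such polynomials \<open>u\<close> and \<open>v\<close> the combination
  \<open>L u \<cdot> v - L v \<cdot> u\<close> lies in the kernel of \<open>L\<close>. It has degree 4 if \<open>p 0\<close> occurs in it with a
  nonzero coefficient.
\<close>

lemma types_glued_triple_and_pair:
  fixes \<alpha> \<beta> \<gamma> \<delta> \<mu> :: "'k::field_char_0"
  assumes A: "poly_subalgebra A" "has_codimension A 3"
    and dist: "distinct [\<alpha>, \<beta>, \<gamma>, \<delta>, \<mu>]"
    and A_eq: "A = {f. poly f \<alpha> = poly f \<beta> \<and> poly f \<beta> = poly f \<mu> \<and> poly f \<gamma> = poly f \<delta>}"
  defines "p \<equiv> \<lambda>i::nat. [:-\<alpha>, 1:] * [:-\<beta>, 1:] * [:-\<gamma>, 1:] * [:-\<delta>, 1:] * [:-\<mu>, 1:] ^ i"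
    and "g \<equiv> [:- ((\<alpha> + \<beta>) / 2), 1:] ^ 2"
    and "\<Delta> \<equiv> \<gamma> + \<delta> - \<alpha> - \<beta>"
  defines "\<tau> \<equiv> (\<gamma>^2 + \<gamma> * \<delta> + \<delta>^2 + \<alpha> * \<beta> - (\<alpha> + \<beta>) * (\<gamma> + \<delta>)) / \<Delta>"
  defines "q \<equiv> [:-\<alpha>, 1:] * [:-\<beta>, 1:] * [:-\<tau>, 1:]"
    and "L \<equiv> \<lambda>f. poly f \<alpha> - poly f \<mu>"
  shows "\<Delta> = 0 \<longrightarrow> subalgebra_type A = [4, 5, 6, 7] \<and>
      SAGBI_basis A {smult (L (p 0)) g - smult (L g) (p 0), p 1, p 2, p 3}"
    and "\<Delta> \<noteq> 0 \<and> L q \<noteq> 0 \<longrightarrow> subalgebra_type A = [4, 5, 6, 7] \<and>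
      SAGBI_basis A {smult (L q) (p 0) - smult (L (p 0)) q, p 1, p 2, p 3}"
    and "\<Delta> \<noteq> 0 \<and> L q = 0 \<and> L (p 0) \<noteq> 0 \<longrightarrow>
      subalgebra_type A = [3, 5, 7] \<and> SAGBI_basis A {q, p 1, p 3}"
    and "\<Delta> \<noteq> 0 \<and> L q = 0 \<and> L (p 0) = 0 \<longrightarrow>
      subalgebra_type A = [3, 4] \<and> SAGBI_basis A {q, p 0}"
proof -
  have deg_p: "degree (p i) = 4 + i" for i
    unfolding p_def by (rule degree_five_point_poly)
  have p_zero: "poly (p i) \<alpha> = 0" "poly (p i) \<beta> = 0" "poly (p i) \<gamma> = 0" "poly (p i) \<delta> = 0" for i
    unfolding p_def poly_five_point_poly_eq_0_iff by simp_all
  have p_mu: "poly (p i) \<mu> = 0" if "i > 0" for i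
    using that unfolding p_def poly_five_point_poly_eq_0_iff by simp
  have p_A: "p i \<in> A" if "i > 0" for i using p_zero p_mu[OF that] by (simp add: A_eq)
  have deg_g: "degree g = 2" unfolding g_def by (rule degree_centred_square)
  have g_diff: "poly g x - poly g y = (x - y) * (x + y - \<alpha> - \<beta>)" for x y
    unfolding g_def by (rule centred_square_diff)
  have Lg: "L g \<noteq> 0" using g_diff[of \<alpha> \<mu>] dist by (auto simp: L_def)
  have deg_q: "degree q = 3" unfolding q_def by (rule degree_cubic)
  have q_ab: "poly q \<alpha> = 0" "poly q \<beta> = 0"
    unfolding q_def by (simp_all del: mult_pCons_left mult_pCons_right)
  have q_cd: "poly q \<gamma> = poly q \<delta>" if "\<Delta> \<noteq> 0"
    using glued_cubic[of \<gamma> \<delta> \<alpha> \<beta>] that unfolding q_def \<tau>_def \<Delta>_def by blast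
  have combination: "smult (L u) v - smult (L v) u \<in> A"
    if "poly u \<alpha> = poly u \<beta>" "poly v \<alpha> = poly v \<beta>" "poly u \<gamma> = poly u \<delta>" "poly v \<gamma> = poly v \<delta>" for u v
    using that by (simp add: A_eq L_def algebra_simps)
  show "\<Delta> = 0 \<longrightarrow> subalgebra_type A = [4, 5, 6, 7] \<and>
      SAGBI_basis A {smult (L (p 0)) g - smult (L g) (p 0), p 1, p 2, p 3}"
  proof
    assume "\<Delta> = 0"
    hence "poly g \<gamma> - poly g \<delta> = 0"
      unfolding g_diff \<Delta>_def by (simp only: mult_zero_right)
    moreover have "poly g \<alpha> - poly g \<beta> = 0" unfolding g_diff by simp
    ultimately have "poly g \<alpha> = poly g \<beta>" "poly g \<gamma> = poly g \<delta>" by simp_all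
    thus "subalgebra_type A = [4, 5, 6, 7] \<and>
      SAGBI_basis A {smult (L (p 0)) g - smult (L g) (p 0), p 1, p 2, p 3}"
      using p_zero p_A deg_p deg_g Lg
      by (intro SAGBI_degrees_4567[OF A] combination)
        (simp_all add: degree_smult_diff_dominant)
  qed
  show "\<Delta> \<noteq> 0 \<and> L q \<noteq> 0 \<longrightarrow> subalgebra_type A = [4, 5, 6, 7] \<and>
      SAGBI_basis A {smult (L q) (p 0) - smult (L (p 0)) q, p 1, p 2, p 3}"
    using p_zero p_A deg_p q_ab q_cd deg_q
    by (intro impI SAGBI_degrees_4567[OF A] combination)
      (simp_all add: degree_smult_diff_dominant)
  have q_A: "q \<in> A" if "\<Delta> \<noteq> 0" "L q = 0"
    using that q_ab q_cd by (simp add: A_eq L_def)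
  have p0_A: "p 0 \<in> A" if "L (p 0) = 0"
    using that p_zero by (simp add: A_eq L_def)
  show "\<Delta> \<noteq> 0 \<and> L q = 0 \<and> L (p 0) \<noteq> 0 \<longrightarrow>
      subalgebra_type A = [3, 5, 7] \<and> SAGBI_basis A {q, p 1, p 3}"
    using q_A p_A deg_p deg_q by (intro impI SAGBI_degrees_357[OF A]) simp_all
  show "\<Delta> \<noteq> 0 \<and> L q = 0 \<and> L (p 0) = 0 \<longrightarrow>
      subalgebra_type A = [3, 4] \<and> SAGBI_basis A {q, p 0}"
    using q_A p0_A deg_p deg_q by (intro impI SAGBI_degrees_34[OF A]) simp_all
qed

text \<open>
  As for the other family, with \<open>D\<close> in place of \<open>L\<close>. The polynomials \<open>p i\<close> with
  \<open>i \<ge> 2\<close> lie in \<open>A\<close>, since \<open>\<mu>\<close> is a multiple root of them. As a simple root of \<open>p 1\<close> it keeps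
  \<open>p 1\<close> out of \<open>A\<close>, so a generator of degree 5 has to be a combination that involves \<open>p 1\<close>. The degree 2 occurs when \<open>\<mu>\<close> is the common midpoint of both pairs, where the derivative
  of \<open>g\<close> vanishes.
\<close>

lemma types_glued_pairs_and_critical_point:
  fixes \<alpha> \<beta> \<gamma> \<delta> \<mu> :: "'k::field_char_0"
  assumes A: "poly_subalgebra A" "has_codimension A 3"
    and dist: "distinct [\<alpha>, \<beta>, \<gamma>, \<delta>, \<mu>]"
    and A_eq: "A = {f. poly f \<alpha> = poly f \<beta> \<and> poly f \<gamma> = poly f \<delta> \<and> poly (pderiv f) \<mu> = 0}"
  defines "p \<equiv> \<lambda>i::nat. [:-\<alpha>, 1:] * [:-\<beta>, 1:] * [:-\<gamma>, 1:] * [:-\<delta>, 1:] * [:-\<mu>, 1:] ^ i"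
    and "g \<equiv> [:- ((\<alpha> + \<beta>) / 2), 1:] ^ 2"
    and "\<Delta> \<equiv> \<gamma> + \<delta> - \<alpha> - \<beta>"
  defines "\<tau> \<equiv> (\<gamma>^2 + \<gamma> * \<delta> + \<delta>^2 + \<alpha> * \<beta> - (\<alpha> + \<beta>) * (\<gamma> + \<delta>)) / \<Delta>"
  defines "q \<equiv> [:-\<alpha>, 1:] * [:-\<beta>, 1:] * [:-\<tau>, 1:]"
    and "D \<equiv> \<lambda>f. poly (pderiv f) \<mu>"
  shows "\<Delta> = 0 \<and> \<mu> = (\<alpha> + \<beta>) / 2 \<longrightarrow>
      subalgebra_type A = [2, 7] \<and> SAGBI_basis A {g, p 3}"
    and "\<Delta> = 0 \<and> \<mu> \<noteq> (\<alpha> + \<beta>) / 2 \<longrightarrow> subalgebra_type A = [4, 5, 6, 7] \<and>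
      SAGBI_basis A {smult (D (p 0)) g - smult (D g) (p 0),
                     smult (D (p 1)) g - smult (D g) (p 1), p 2, p 3}"
    and "\<Delta> \<noteq> 0 \<and> D q \<noteq> 0 \<longrightarrow> subalgebra_type A = [4, 5, 6, 7] \<and>
      SAGBI_basis A {smult (D (p 0)) q - smult (D q) (p 0),
                     smult (D (p 1)) q - smult (D q) (p 1), p 2, p 3}"
    and "\<Delta> \<noteq> 0 \<and> D q = 0 \<and> D (p 0) \<noteq> 0 \<longrightarrow> subalgebra_type A = [3, 5, 7] \<and>
      SAGBI_basis A {q, smult (D (p 0)) (p 1) - smult (D (p 1)) (p 0), p 3}"
    and "\<Delta> \<noteq> 0 \<and> D q = 0 \<and> D (p 0) = 0 \<longrightarrow>
      subalgebra_type A = [3, 4] \<and> SAGBI_basis A {q, p 0}"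
proof -
  have deg_p: "degree (p i) = 4 + i" for i
    unfolding p_def by (rule degree_five_point_poly)
  have p_zero: "poly (p i) \<alpha> = 0" "poly (p i) \<beta> = 0" "poly (p i) \<gamma> = 0" "poly (p i) \<delta> = 0" for i
    unfolding p_def poly_five_point_poly_eq_0_iff by simp_all
  have p_mu: "poly (p i) \<mu> = 0" if "i > 0" for i
    using that unfolding p_def poly_five_point_poly_eq_0_iff by simp
  \<comment> \<open>The product rule for the factor \<open>x - \<mu>\<close>.\<close>
  have Dp: "D (p (Suc i)) = poly (p i) \<mu>" for i
  proof -
    have "p (Suc i) = p i * [:-\<mu>, 1:]" unfolding p_def power_Suc2 by (simp only: mult.assoc)
    thus ?thesis
      by (simp add: D_def pderiv_mult pderiv_pCons del: mult_pCons_left mult_pCons_right)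
  qed
  have p_A: "p i \<in> A" if "i > 1" for i
    using p_zero Dp[of "i - 1"] p_mu[of "i - 1"] that by (simp add: A_eq D_def)
  have deg_g: "degree g = 2" unfolding g_def by (rule degree_centred_square)
  have g_diff: "poly g x - poly g y = (x - y) * (x + y - \<alpha> - \<beta>)" for x y
    unfolding g_def by (rule centred_square_diff)
  have g_glued: "poly g \<alpha> = poly g \<beta>" "poly g \<gamma> = poly g \<delta>" if "\<Delta> = 0"
  proof -
    have "poly g \<gamma> - poly g \<delta> = 0"
      using that unfolding g_diff \<Delta>_def by (simp only: mult_zero_right)
    moreover have "poly g \<alpha> - poly g \<beta> = 0" unfolding g_diff by simp
    ultimately show "poly g \<alpha> = poly g \<beta>" "poly g \<gamma> = poly g \<delta>" by simp_all
  qed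
  have Dg: "D g = 0 \<longleftrightarrow> \<mu> = (\<alpha> + \<beta>) / 2"
  proof -
    define m where "m = (\<alpha> + \<beta>) / 2"
    have "D g = 2 * (\<mu> - m)"
      unfolding D_def g_def m_def[symmetric]
      by (simp add: power2_eq_square pderiv_mult pderiv_pCons algebra_simps)
    thus ?thesis unfolding m_def[symmetric] by simp
  qed
  have deg_q: "degree q = 3" unfolding q_def by (rule degree_cubic)
  have q_ab: "poly q \<alpha> = 0" "poly q \<beta> = 0"
    unfolding q_def by (simp_all del: mult_pCons_left mult_pCons_right)
  have q_cd: "poly q \<gamma> = poly q \<delta>" if "\<Delta> \<noteq> 0"
    using glued_cubic[of \<gamma> \<delta> \<alpha> \<beta>] that unfolding q_def \<tau>_def \<Delta>_def by blast
  have combination: "smult (D u) v - smult (D v) u \<in> A"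
    if "poly u \<alpha> = poly u \<beta>" "poly v \<alpha> = poly v \<beta>" "poly u \<gamma> = poly u \<delta>" "poly v \<gamma> = poly v \<delta>" for u v
    using that by (simp add: A_eq D_def pderiv_diff pderiv_smult algebra_simps)
  show "\<Delta> = 0 \<and> \<mu> = (\<alpha> + \<beta>) / 2 \<longrightarrow>
      subalgebra_type A = [2, 7] \<and> SAGBI_basis A {g, p 3}"
  proof
    assume *: "\<Delta> = 0 \<and> \<mu> = (\<alpha> + \<beta>) / 2"
    hence "\<Delta> = 0" "D g = 0" using Dg by blast+
    hence "g \<in> A" using g_glued by (simp add: A_eq D_def)
    thus "subalgebra_type A = [2, 7] \<and> SAGBI_basis A {g, p 3}"
      using p_A deg_p deg_g by (intro SAGBI_degrees_27[OF A]) simp_all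
  qed
  show "\<Delta> = 0 \<and> \<mu> \<noteq> (\<alpha> + \<beta>) / 2 \<longrightarrow> subalgebra_type A = [4, 5, 6, 7] \<and>
      SAGBI_basis A {smult (D (p 0)) g - smult (D g) (p 0),
                     smult (D (p 1)) g - smult (D g) (p 1), p 2, p 3}"
  proof
    assume *: "\<Delta> = 0 \<and> \<mu> \<noteq> (\<alpha> + \<beta>) / 2"
    hence "D g \<noteq> 0" using Dg by blast
    thus "subalgebra_type A = [4, 5, 6, 7] \<and>
      SAGBI_basis A {smult (D (p 0)) g - smult (D g) (p 0),
                     smult (D (p 1)) g - smult (D g) (p 1), p 2, p 3}"
      using p_zero p_A deg_p deg_g g_glued *
      by (intro SAGBI_degrees_4567[OF A] combination)
        (simp_all add: degree_smult_diff_dominant)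
  qed
  show "\<Delta> \<noteq> 0 \<and> D q \<noteq> 0 \<longrightarrow> subalgebra_type A = [4, 5, 6, 7] \<and>
      SAGBI_basis A {smult (D (p 0)) q - smult (D q) (p 0),
                     smult (D (p 1)) q - smult (D q) (p 1), p 2, p 3}"
    using p_zero p_A deg_p q_ab q_cd deg_q
    by (intro impI SAGBI_degrees_4567[OF A] combination)
      (simp_all add: degree_smult_diff_dominant)
  have q_A: "q \<in> A" if "\<Delta> \<noteq> 0" "D q = 0"
    using that q_ab q_cd by (simp add: A_eq D_def)
  have p0_A: "p 0 \<in> A" if "D (p 0) = 0"
    using that p_zero by (simp add: A_eq D_def)
  show "\<Delta> \<noteq> 0 \<and> D q = 0 \<and> D (p 0) \<noteq> 0 \<longrightarrow> subalgebra_type A = [3, 5, 7] \<and>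
      SAGBI_basis A {q, smult (D (p 0)) (p 1) - smult (D (p 1)) (p 0), p 3}"
    using p_zero p_A deg_p deg_q q_A
    by (intro impI SAGBI_degrees_357[OF A] combination)
      (simp_all add: degree_smult_diff_dominant)
  show "\<Delta> \<noteq> 0 \<and> D q = 0 \<and> D (p 0) = 0 \<longrightarrow>
      subalgebra_type A = [3, 4] \<and> SAGBI_basis A {q, p 0}"
    using q_A p0_A deg_p deg_q by (intro impI SAGBI_degrees_34[OF A]) simp_all
qed

theorem theorem45:
  fixes A :: "'k::{alg_closed_field, field_char_0} poly set"
  assumes "poly_subalgebra A"
    and "has_codimension A 3"
    and "card (spectrum A) = 5"
  shows "\<exists>\<alpha> \<beta> \<gamma> \<delta> \<mu>.
    distinct [\<alpha>, \<beta>, \<gamma>, \<delta>, \<mu>] \<and> spectrum A = {\<alpha>, \<beta>, \<gamma>, \<delta>, \<mu>} \<and>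
    (let p = (\<lambda>i::nat. [:-\<alpha>, 1:] * [:-\<beta>, 1:] * [:-\<gamma>, 1:] * [:-\<delta>, 1:] * [:-\<mu>, 1:] ^ i);
         g = [:- ((\<alpha> + \<beta>) / 2), 1:] ^ 2;
         \<Delta> = \<gamma> + \<delta> - \<alpha> - \<beta>;
         \<tau> = (\<gamma>^2 + \<gamma> * \<delta> + \<delta>^2 + \<alpha> * \<beta> - (\<alpha> + \<beta>) * (\<gamma> + \<delta>)) / \<Delta>;
         q = [:-\<alpha>, 1:] * [:-\<beta>, 1:] * [:-\<tau>, 1:];
         L = (\<lambda>f. poly f \<alpha> - poly f \<mu>);
         D = (\<lambda>f. poly (pderiv f) \<mu>)
     in
      (A = {f. poly f \<alpha> = poly f \<beta> \<and> poly f \<beta> = poly f \<mu> \<and> poly f \<gamma> = poly f \<delta>} \<and>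
       (\<Delta> = 0 \<longrightarrow>
          subalgebra_type A = [4, 5, 6, 7] \<and>
          SAGBI_basis A {smult (L (p 0)) g - smult (L g) (p 0), p 1, p 2, p 3}) \<and>
       (\<Delta> \<noteq> 0 \<and> L q \<noteq> 0 \<longrightarrow>
          subalgebra_type A = [4, 5, 6, 7] \<and>
          SAGBI_basis A {smult (L q) (p 0) - smult (L (p 0)) q, p 1, p 2, p 3}) \<and>
       (\<Delta> \<noteq> 0 \<and> L q = 0 \<and> L (p 0) \<noteq> 0 \<longrightarrow>
          subalgebra_type A = [3, 5, 7] \<and>
          SAGBI_basis A {q, p 1, p 3}) \<and>
       (\<Delta> \<noteq> 0 \<and> L q = 0 \<and> L (p 0) = 0 \<longrightarrow>
          subalgebra_type A = [3, 4] \<and>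
          SAGBI_basis A {q, p 0}))
      \<or>
      (A = {f. poly f \<alpha> = poly f \<beta> \<and> poly f \<gamma> = poly f \<delta> \<and> poly (pderiv f) \<mu> = 0} \<and>
       (\<Delta> = 0 \<and> \<mu> = (\<alpha> + \<beta>) / 2 \<longrightarrow>
          subalgebra_type A = [2, 7] \<and>
          SAGBI_basis A {g, p 3}) \<and>
       (\<Delta> = 0 \<and> \<mu> \<noteq> (\<alpha> + \<beta>) / 2 \<longrightarrow>
          subalgebra_type A = [4, 5, 6, 7] \<and>
          SAGBI_basis A {smult (D (p 0)) g - smult (D g) (p 0),
                         smult (D (p 1)) g - smult (D g) (p 1), p 2, p 3}) \<and>
       (\<Delta> \<noteq> 0 \<and> D q \<noteq> 0 \<longrightarrow>
          subalgebra_type A = [4, 5, 6, 7] \<and>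
          SAGBI_basis A {smult (D (p 0)) q - smult (D q) (p 0),
                         smult (D (p 1)) q - smult (D q) (p 1), p 2, p 3}) \<and>
       (\<Delta> \<noteq> 0 \<and> D q = 0 \<and> D (p 0) \<noteq> 0 \<longrightarrow>
          subalgebra_type A = [3, 5, 7] \<and>
          SAGBI_basis A {q, smult (D (p 0)) (p 1) - smult (D (p 1)) (p 0), p 3}) \<and>
       (\<Delta> \<noteq> 0 \<and> D q = 0 \<and> D (p 0) = 0 \<longrightarrow>
          subalgebra_type A = [3, 4] \<and>
          SAGBI_basis A {q, p 0})))"
proof -
  from five_spectral_points_cases[OF assms] obtain \<alpha> \<beta> \<gamma> \<delta> \<mu> where
    dist: "distinct [\<alpha>, \<beta>, \<gamma>, \<delta>, \<mu>]" and Sp: "spectrum A = {\<alpha>, \<beta>, \<gamma>, \<delta>, \<mu>}" and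
    glued: "\<forall>f\<in>A. poly f \<alpha> = poly f \<beta>" "\<forall>f\<in>A. poly f \<gamma> = poly f \<delta>" and
    fifth: "(\<forall>f\<in>A. poly f \<alpha> = poly f \<mu>) \<or> (\<forall>f\<in>A. poly (pderiv f) \<mu> = 0)" .
  from fifth show ?thesis
  proof
    assume "\<forall>f\<in>A. poly f \<alpha> = poly f \<mu>"
    note A_eq = glued_triple_and_pair_determine[OF assms(1,2) dist glued this]
    note types = types_glued_triple_and_pair[OF assms(1,2) dist A_eq]
    show ?thesis
      unfolding Let_def
      by (rule exI[of _ \<alpha>], rule exI[of _ \<beta>], rule exI[of _ \<gamma>], rule exI[of _ \<delta>], rule exI[of _ \<mu>])
        (intro conjI disjI1 dist Sp A_eq types)
  next
    assume "\<forall>f\<in>A. poly (pderiv f) \<mu> = 0"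
    note A_eq = glued_pairs_and_critical_point_determine[OF assms(1,2) dist glued this]
    note types = types_glued_pairs_and_critical_point[OF assms(1,2) dist A_eq]
    show ?thesis
      unfolding Let_def
      by (rule exI[of _ \<alpha>], rule exI[of _ \<beta>], rule exI[of _ \<gamma>], rule exI[of _ \<delta>], rule exI[of _ \<mu>])
        (intro conjI disjI2 dist Sp A_eq types)
  qed
qed

end
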